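(* Let $\Gamma$ be a totally ordered abelian group with divisible hull $\Gamma_{\mathbb{Q}}$. Let $D$ be a proper ball cut in $\Gamma_{\mathbb{Q}}$, and let $S\in\mathrm{Init}(I)$ be the initial segment such that $H_S$ is the invariance group of $D$. Then the cofinality $\kappa(D)$ and coinitiality $\lambda(D)$ of $D$ take the following values, according to the subtype of $D$ (a sequence of three signs): $(+,+,+)$: $\kappa(D)=\aleph_0$, $\lambda(D)=\aleph_0$. $(+,+,-)$: $\kappa(D)=\lambda(S)$, $\lambda(D)=\aleph_0$. $(+,-,+)$: $\kappa(D)=\aleph_0$, $\lambda(D)=\kappa(S)$. $(+,-,-)$: $\kappa(D)=\lambda(S)$, $\lambda(D)=\kappa(S)$. $(-,+,+)$: $\kappa(D)=\aleph_0$, $\lambda(D)=\aleph_0$. $(-,+,-)$: $\kappa(D)=\aleph_0$, $\lambda(D)=\lambda(S)$. $(-,-,+)$: $\kappa(D)=\kappa(S)$, $\lambda(D)=\aleph_0$. $(-,-,-)$: $\kappa(D)=\kappa(S)$, $\lambda(D)=\lambda(S)$.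
   Context: $\Gamma_{\mathbb{Q}}=\Gamma\otimes_{\mathbb{Z}}\mathbb{Q}$ with its natural ordering extending that of $\Gamma$. A cut in an ordered set or group $G$ is a pair $D=(D^L,D^R)$ of subsets with $D^L<D^R$ and $D^L\cup D^R=G$; the cuts $(\emptyset,G)$, $(G,\emptyset)$ are called improper, the others proper. $\kappa(D)$ is the cofinality of $D^L$ (least cardinality of a cofinal subset), and $\lambda(D)$ is the coinitiality of $D^R$ (least cardinality of a coinitial subset). For $M\subset G$, $M^+$ is the cut with initial segment $\{g\in G\mid \exists m\in M:\ g\le m\}$ and $M^-$ is the cut with initial segment $\{g\in G\mid g<M\}$. The invariance group of a cut $D$ in an ordered abelian group $G$ is the convex subgroup $H(D)=\{h\in G\mid D^L+h=D^L\}$, where $\emptyset+h=\emptyset$. $D$ is a ball cut if the cut $(D^L/H,D^R/H)$ in $G/H$, $H=H(D)$, is principal (of the form $\{c\}^+$ or $\{c\}^-$). Equivalently, $D=(a+H)^+$ or $D=(a+H)^-$ for some $a\in G$, with $H=H(D)$. Let $I$ be the set of nonzero principal convex subgroups $H(a)=\{b\mid |b|\le n|a|\text{ for some }n\in\mathbb{N}\}$ ($a\neq0$) of $\Gamma_{\mathbb{Q}}$, ordered by descending inclusion (naturally identified with the corresponding set for $\Gamma$). Denote by $H_i$ the subgroup corresponding to $i\in I$. $\mathrm{Init}(I)$ is the set of initial segments of $I$ (including $\emptyset$, $I$). For $S\in\mathrm{Init}(I)$ put $S^c=I\setminus S$ and $H_S=\bigcup_{i\in S^c}H_i$ (equal to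 $\{0\}$ if $S=I$); every convex subgroup of $\Gamma_{\mathbb{Q}}$ is $H_S$ for a unique $S$. Denote by $\kappa(S)$ the cofinality of $S$ and by $\lambda(S)$ the coinitiality of $S^c$ (for the ordering of $I$), with the convention $\lambda(S)=1$ if $S=I$, $S^c=\emptyset$. The subtype $(\pm,\pm,\pm)$ of a proper ball cut $D$ with invariance group $H=H_S$ is defined as follows. First sign: $+$ if $D=(a+H)^+$, and $-$ if $D=(a+H)^-$, for some $a\in\Gamma_{\mathbb{Q}}$. Second sign: $+$ if $\max(S)$ exists, $-$ if it does not. Third sign: $+$ if $\min(S^c)$ exists, $-$ if it does not. *)

theory Defs
  imports Main
begin

unbundle cardinal_syntax

section \<open>Natural multiples\<close>

primrec nsmul :: "nat \<Rightarrow> 'a::comm_monoid_add \<Rightarrow> 'a" where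
  "nsmul 0 a = 0"
| "nsmul (Suc n) a = a + nsmul n a"

lemma nsmul_zero [simp]: "nsmul n 0 = 0"
  by (induction n) auto

lemma nsmul_one [simp]: "nsmul (Suc 0) a = a"
  by simp

lemma nsmul_add_left: "nsmul (m + n) a = nsmul m a + nsmul n a"
  by (induction m) (auto simp: add.assoc)

lemma nsmul_add_right: "nsmul n (a + b) = nsmul n a + nsmul n b"
  by (induction n) (auto simp: ac_simps)

lemma nsmul_mult: "nsmul (m * n) a = nsmul m (nsmul n a)"
  by (induction m) (auto simp: nsmul_add_left)

lemma nsmul_commute: "nsmul m (nsmul n a) = nsmul n (nsmul m a)"
  by (metis nsmul_mult mult.commute)

lemma nsmul_minus: "nsmul n (- a) = - nsmul n (a :: 'a::ab_group_add)"
  by (induction n) auto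

lemma nsmul_mono: "a \<le> b \<Longrightarrow> nsmul n a \<le> nsmul n (b :: 'a::ordered_comm_monoid_add)"
  by (induction n) (auto intro: add_mono)

lemma nsmul_strict_mono:
  fixes a b :: "'a::linordered_ab_group_add"
  assumes "a < b" "n > 0"
  shows "nsmul n a < nsmul n b"
proof -
  obtain k where "n = Suc k" using assms(2) by (cases n) auto
  then show ?thesis
    using assms(1) nsmul_mono[of a b k] by (auto intro: add_less_le_mono)
qed

lemma nsmul_le_iff:
  fixes a b :: "'a::linordered_ab_group_add"
  shows "n > 0 \<Longrightarrow> nsmul n a \<le> nsmul n b \<longleftrightarrow> a \<le> b"
  by (meson linorder_not_less nsmul_mono nsmul_strict_mono)

lemma nsmul_eq_iff:
  fixes a b :: "'a::linordered_ab_group_add"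
  shows "n > 0 \<Longrightarrow> nsmul n a = nsmul n b \<longleftrightarrow> a = b"
  by (metis nsmul_le_iff order_antisym order_refl)


section \<open>The divisible hull\<close>

text \<open>
  The divisible hull of an ordered abelian group, in the form of its localisation at the positive
  integers: the pair \<open>(a, n)\<close> with \<open>n > 0\<close> stands for the fraction \<open>a / n\<close>, that is, for the
  element \<open>a \<otimes> (1/n)\<close> of the tensor product with the rationals. An ordered group is torsion free,
  so two fractions agree iff they do after clearing denominators.
\<close>

definition fracrel :: "'a::linordered_ab_group_add \<times> nat \<Rightarrow> 'a \<times> nat \<Rightarrow> bool" where
  "fracrel x y \<longleftrightarrow> snd x > 0 \<and> snd y > 0 \<and> nsmul (snd y) (fst x) = nsmul (snd x) (fst y)"

lemma part_equivp_fracrel: "part_equivp (fracrel :: 'a::linordered_ab_group_add \<times> nat \<Rightarrow> _)"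
proof (rule part_equivpI)
  show "\<exists>x :: 'a \<times> nat. fracrel x x"
    by (rule exI[of _ "(0, 1)"]) (simp add: fracrel_def)
  show "symp (fracrel :: 'a \<times> nat \<Rightarrow> _)"
    by (auto simp: symp_def fracrel_def)
  show "transp (fracrel :: 'a \<times> nat \<Rightarrow> _)"
  proof (rule transpI)
    fix x y z :: "'a \<times> nat"
    assume xy: "fracrel x y" and yz: "fracrel y z"
    have "nsmul (snd y) (nsmul (snd z) (fst x)) = nsmul (snd y) (nsmul (snd x) (fst z))"
      using xy yz unfolding fracrel_def by (metis nsmul_commute)
    moreover have "snd x > 0" "snd y > 0" "snd z > 0"
      using xy yz by (auto simp: fracrel_def)
    ultimately show "fracrel x z"
      unfolding fracrel_def using nsmul_eq_iff by blast
  qed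
qed

lemma fracrel_scale:
  assumes "fracrel x x'" "a = snd x' * c" "b = snd x * c"
  shows "nsmul a (fst x) = nsmul b (fst x')"
proof -
  have "nsmul c (nsmul (snd x') (fst x)) = nsmul c (nsmul (snd x) (fst x'))"
    using assms(1) by (simp add: fracrel_def)
  then show ?thesis
    unfolding assms(2,3) by (simp only: nsmul_mult[symmetric] mult.commute)
qed

quotient_type (overloaded) 'a div_hull = "'a::linordered_ab_group_add \<times> nat" / partial: fracrel
  morphisms Rep_div_hull Abs_div_hull
  by (rule part_equivp_fracrel)

instantiation div_hull :: (linordered_ab_group_add) ab_group_add
begin

lift_definition zero_div_hull :: "'a div_hull" is "(0, 1)"
  by (simp add: fracrel_def)

lift_definition plus_div_hull :: "'a div_hull \<Rightarrow> 'a div_hull \<Rightarrow> 'a div_hull"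
  is "\<lambda>x y. (nsmul (snd y) (fst x) + nsmul (snd x) (fst y), snd x * snd y)"
proof -
  fix x x' y y' :: "'a \<times> nat"
  assume x: "fracrel x x'" and y: "fracrel y y'"
  have 1: "nsmul (snd x' * snd y') (nsmul (snd y) (fst x))
      = nsmul (snd x * snd y) (nsmul (snd y') (fst x'))"
    unfolding nsmul_mult[symmetric] by (rule fracrel_scale[OF x, where c = "snd y' * snd y"]) simp_all
  have 2: "nsmul (snd x' * snd y') (nsmul (snd x) (fst y))
      = nsmul (snd x * snd y) (nsmul (snd x') (fst y'))"
    unfolding nsmul_mult[symmetric] by (rule fracrel_scale[OF y, where c = "snd x' * snd x"]) simp_all
  show "fracrel (nsmul (snd y) (fst x) + nsmul (snd x) (fst y), snd x * snd y)
      (nsmul (snd y') (fst x') + nsmul (snd x') (fst y'), snd x' * snd y')"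
    using x y by (simp add: fracrel_def nsmul_add_right 1 2)
qed

lift_definition uminus_div_hull :: "'a div_hull \<Rightarrow> 'a div_hull"
  is "\<lambda>x. (- fst x, snd x)"
  by (auto simp: fracrel_def nsmul_minus)

definition minus_div_hull :: "'a div_hull \<Rightarrow> 'a div_hull \<Rightarrow> 'a div_hull"
  where "minus_div_hull x y = x + - y"

instance
proof
  fix x y z :: "'a div_hull"
  show "x + y + z = x + (y + z)"
  proof transfer
    fix x y z :: "'a \<times> nat"
    assume "fracrel x x" "fracrel y y" "fracrel z z"
    then have pos: "snd x > 0" "snd y > 0" "snd z > 0"
      by (auto simp: fracrel_def)
    have "nsmul (snd z) (nsmul (snd y) (fst x) + nsmul (snd x) (fst y)) + nsmul (snd x * snd y) (fst z)
        = nsmul (snd y * snd z) (fst x) + nsmul (snd x) (nsmul (snd z) (fst y) + nsmul (snd y) (fst z))"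
      by (simp only: nsmul_add_right nsmul_mult[symmetric] mult.commute add.assoc)
    with pos show "fracrel
        (nsmul (snd z) (fst (nsmul (snd y) (fst x) + nsmul (snd x) (fst y), snd x * snd y)) +
          nsmul (snd (nsmul (snd y) (fst x) + nsmul (snd x) (fst y), snd x * snd y)) (fst z),
          snd (nsmul (snd y) (fst x) + nsmul (snd x) (fst y), snd x * snd y) * snd z)
        (nsmul (snd (nsmul (snd z) (fst y) + nsmul (snd y) (fst z), snd y * snd z)) (fst x) +
          nsmul (snd x) (fst (nsmul (snd z) (fst y) + nsmul (snd y) (fst z), snd y * snd z)),
          snd x * snd (nsmul (snd z) (fst y) + nsmul (snd y) (fst z), snd y * snd z))"
      by (simp add: fracrel_def mult.assoc)
  qed
  show "x + y = y + x"
    by transfer (auto simp: fracrel_def ac_simps)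
  show "0 + x = x"
    by transfer (auto simp: fracrel_def)
  show "- x + x = 0"
    by transfer (auto simp: fracrel_def nsmul_minus)
  show "x - y = x + - y"
    by (rule minus_div_hull_def)
qed

end

instantiation div_hull :: (linordered_ab_group_add) linordered_ab_group_add
begin

lift_definition less_eq_div_hull :: "'a div_hull \<Rightarrow> 'a div_hull \<Rightarrow> bool"
  is "\<lambda>x y. nsmul (snd y) (fst x) \<le> nsmul (snd x) (fst y)"
proof -
  fix x x' y y' :: "'a \<times> nat"
  assume x: "fracrel x x'" and y: "fracrel y y'"
  have "nsmul (snd y) (fst x) \<le> nsmul (snd x) (fst y) \<longleftrightarrow>
      nsmul (snd x' * snd y') (nsmul (snd y) (fst x)) \<le> nsmul (snd x' * snd y') (nsmul (snd x) (fst y))"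
    using x y by (intro nsmul_le_iff[symmetric]) (auto simp: fracrel_def)
  also have "nsmul (snd x' * snd y') (nsmul (snd y) (fst x))
      = nsmul (snd x * snd y) (nsmul (snd y') (fst x'))"
    unfolding nsmul_mult[symmetric] by (rule fracrel_scale[OF x, where c = "snd y' * snd y"]) simp_all
  also have "nsmul (snd x' * snd y') (nsmul (snd x) (fst y))
      = nsmul (snd x * snd y) (nsmul (snd x') (fst y'))"
    unfolding nsmul_mult[symmetric] by (rule fracrel_scale[OF y, where c = "snd x' * snd x"]) simp_all
  also have "nsmul (snd x * snd y) (nsmul (snd y') (fst x'))
        \<le> nsmul (snd x * snd y) (nsmul (snd x') (fst y')) \<longleftrightarrow>
      nsmul (snd y') (fst x') \<le> nsmul (snd x') (fst y')"
    using x y by (intro nsmul_le_iff) (auto simp: fracrel_def)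
  finally show "nsmul (snd y) (fst x) \<le> nsmul (snd x) (fst y) \<longleftrightarrow>
      nsmul (snd y') (fst x') \<le> nsmul (snd x') (fst y')" .
qed

definition less_div_hull :: "'a div_hull \<Rightarrow> 'a div_hull \<Rightarrow> bool"
  where "less_div_hull x y \<longleftrightarrow> x \<le> y \<and> \<not> y \<le> x"

instance
proof -
  have trans: "x \<le> z" if "x \<le> y" "y \<le> z" for x y z :: "'a div_hull"
    using that
  proof transfer
    fix x y z :: "'a \<times> nat"
    assume "fracrel x x" "fracrel y y" "fracrel z z"
      and xy: "nsmul (snd y) (fst x) \<le> nsmul (snd x) (fst y)"
      and yz: "nsmul (snd z) (fst y) \<le> nsmul (snd y) (fst z)"
    then have pos: "snd x > 0" "snd y > 0" "snd z > 0"
      by (auto simp: fracrel_def)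
    have "nsmul (snd y) (nsmul (snd z) (fst x)) \<le> nsmul (snd y) (nsmul (snd x) (fst z))"
      using nsmul_mono[OF xy, of "snd z"] nsmul_mono[OF yz, of "snd x"]
      by (simp only: nsmul_commute[of "snd z" "snd y"] nsmul_commute[of "snd x" "snd z"]
        nsmul_commute[of "snd x" "snd y"])
    then show "nsmul (snd z) (fst x) \<le> nsmul (snd x) (fst z)"
      using pos by (simp add: nsmul_le_iff)
  qed
  have refl: "x \<le> x" for x :: "'a div_hull"
    by transfer simp
  have antisym: "x = y" if "x \<le> y" "y \<le> x" for x y :: "'a div_hull"
    using that by transfer (simp add: fracrel_def)
  have total: "x \<le> y \<or> y \<le> x" for x y :: "'a div_hull"
    by transfer (simp add: linear)
  have add: "z + x \<le> z + y" if "x \<le> y" for x y z :: "'a div_hull"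
    using that
  proof transfer
    fix x y z :: "'a \<times> nat"
    assume xy: "nsmul (snd y) (fst x) \<le> nsmul (snd x) (fst y)"
    have "nsmul (snd z * snd y) (nsmul (snd z) (fst x)) \<le> nsmul (snd z * snd x) (nsmul (snd z) (fst y))"
      using nsmul_mono[OF xy, of "snd z * snd z"] by (simp add: nsmul_mult[symmetric] ac_simps)
    moreover have "nsmul (snd z * snd y) (nsmul (snd x) (fst z)) = nsmul (snd z * snd x) (nsmul (snd y) (fst z))"
      by (simp add: nsmul_mult[symmetric] ac_simps)
    ultimately show "nsmul (snd (nsmul (snd y) (fst z) + nsmul (snd z) (fst y), snd z * snd y))
          (fst (nsmul (snd x) (fst z) + nsmul (snd z) (fst x), snd z * snd x))
        \<le> nsmul (snd (nsmul (snd x) (fst z) + nsmul (snd z) (fst x), snd z * snd x))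
          (fst (nsmul (snd y) (fst z) + nsmul (snd z) (fst y), snd z * snd y))"
      by (simp add: nsmul_add_right)
  qed
  show "OFCLASS('a div_hull, linordered_ab_group_add_class)"
  proof standard
    fix x y z :: "'a div_hull"
    show "x < y \<longleftrightarrow> x \<le> y \<and> \<not> y \<le> x"
      by (rule less_div_hull_def)
    show "x \<le> x"
      by (rule refl)
    show "x \<le> y \<Longrightarrow> y \<le> z \<Longrightarrow> x \<le> z"
      by (rule trans)
    show "x \<le> y \<Longrightarrow> y \<le> x \<Longrightarrow> x = y"
      by (rule antisym)
    show "x \<le> y \<or> y \<le> x"
      by (rule total)
    show "x \<le> y \<Longrightarrow> z + x \<le> z + y"
      by (rule add)
  qed
qed

end

instantiation div_hull :: (linordered_ab_group_add) ordered_ab_group_add_abs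
begin

definition abs_div_hull :: "'a div_hull \<Rightarrow> 'a div_hull"
  where "abs_div_hull x = (if x < 0 then - x else x)"

instance
proof
  fix a b :: "'a div_hull"
  have ge: "x \<le> \<bar>x\<bar>" "- x \<le> \<bar>x\<bar>" for x :: "'a div_hull"
    by (auto simp: abs_div_hull_def)
  have le: "x \<le> y \<Longrightarrow> - x \<le> y \<Longrightarrow> \<bar>x\<bar> \<le> y" for x y :: "'a div_hull"
    by (auto simp: abs_div_hull_def)
  show "0 \<le> \<bar>a\<bar>"
    by (auto simp: abs_div_hull_def)
  show "a \<le> \<bar>a\<bar>"
    by (rule ge)
  show "a \<le> b \<Longrightarrow> - a \<le> b \<Longrightarrow> \<bar>a\<bar> \<le> b"
    by (rule le)
  show "\<bar>- a\<bar> = \<bar>a\<bar>"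
    by (auto simp: abs_div_hull_def)
  show "\<bar>a + b\<bar> \<le> \<bar>a\<bar> + \<bar>b\<bar>"
    using add_mono[OF ge(1)[of a] ge(1)[of b]] add_mono[OF ge(2)[of a] ge(2)[of b]]
    by (intro le) (auto simp: algebra_simps)
qed

end

text \<open>
  The defining properties of the divisible hull: an order embedding of the given group, with
  divisible target, such that every element has a positive multiple in the image.
\<close>

lift_definition to_div_hull :: "'a::linordered_ab_group_add \<Rightarrow> 'a div_hull" is "\<lambda>a. (a, 1)"
  by (simp add: fracrel_def)

lemma to_div_hull_add: "to_div_hull (a + b) = to_div_hull a + to_div_hull b"
  by transfer (simp add: fracrel_def)

lemma to_div_hull_le_iff: "to_div_hull a \<le> to_div_hull b \<longleftrightarrow> a \<le> b"
  by transfer simp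

lemma nsmul_Abs_div_hull:
  assumes "m > 0"
  shows "nsmul n (Abs_div_hull (a, m)) = Abs_div_hull (nsmul n a, m)"
proof (induction n)
  case 0
  have "fracrel (0, 1) (0 :: 'a, m)"
    using assms by (simp add: fracrel_def)
  then show ?case
    using Quotient_rel_abs[OF Quotient_div_hull] by (fastforce simp: zero_div_hull_def)
next
  case (Suc n)
  have 1: "fracrel (a, m) (a, m)" and 2: "fracrel (nsmul n a, m) (nsmul n a, m)"
    using assms by (simp_all add: fracrel_def)
  have 3: "fracrel (nsmul m a + nsmul m (nsmul n a), m * m) (a + nsmul n a, m)"
    using assms by (simp add: fracrel_def nsmul_add_right nsmul_mult)
  have "nsmul (Suc n) (Abs_div_hull (a, m)) = Abs_div_hull (nsmul m a + nsmul m (nsmul n a), m * m)"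
    using plus_div_hull.abs_eq[OF 1 2] Suc by simp
  also have "\<dots> = Abs_div_hull (nsmul (Suc n) a, m)"
    using Quotient_rel_abs[OF Quotient_div_hull 3] by simp
  finally show ?case .
qed

lemma div_hull_cases:
  obtains a m where "m > 0" "x = Abs_div_hull (a, m)"
proof -
  have "fracrel (Rep_div_hull x) (Rep_div_hull x)" "Abs_div_hull (Rep_div_hull x) = x"
    using Quotient_rep_reflp[OF Quotient_div_hull] Quotient_abs_rep[OF Quotient_div_hull] by blast+
  then show ?thesis
    using that[of "snd (Rep_div_hull x)" "fst (Rep_div_hull x)"] by (auto simp: fracrel_def)
qed

lemma div_hull_multiple: "\<exists>n>0. \<exists>a. nsmul n x = to_div_hull a"
proof -
  obtain a m where m: "m > 0" "x = Abs_div_hull (a, m)"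
    by (rule div_hull_cases)
  have "fracrel (nsmul m a, m) (a, 1)"
    using m by (simp add: fracrel_def)
  then show ?thesis
    using m Quotient_rel_abs[OF Quotient_div_hull]
    by (metis nsmul_Abs_div_hull to_div_hull.abs_eq)
qed

lemma div_hull_divisible:
  assumes "n > 0"
  shows "\<exists>y. nsmul n y = (x :: 'a::linordered_ab_group_add div_hull)"
proof -
  obtain a m where m: "m > 0" "x = Abs_div_hull (a, m)"
    by (rule div_hull_cases)
  have "fracrel (nsmul n a, n * m) (a, m)"
    using m assms by (simp add: fracrel_def nsmul_mult[symmetric] mult.commute)
  then have "Abs_div_hull (nsmul n a, n * m) = Abs_div_hull (a, m)"
    by (rule Quotient_rel_abs[OF Quotient_div_hull])
  then show ?thesis
    using m assms nsmul_Abs_div_hull[of "n * m" n a] by auto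
qed


section \<open>Cofinality and coinitiality\<close>

definition cofinal_subset :: "('a \<Rightarrow> 'a \<Rightarrow> bool) \<Rightarrow> 'a set \<Rightarrow> 'a set \<Rightarrow> bool" where
  "cofinal_subset le A B \<longleftrightarrow> B \<subseteq> A \<and> (\<forall>a\<in>A. \<exists>b\<in>B. le a b)"

definition cofinality :: "('a \<Rightarrow> 'a \<Rightarrow> bool) \<Rightarrow> 'a set \<Rightarrow> 'a rel" where
  "cofinality le A =
    |SOME B. cofinal_subset le A B \<and> (\<forall>C. cofinal_subset le A C \<longrightarrow> |B| \<le>o |C| )|"

definition coinitiality :: "('a \<Rightarrow> 'a \<Rightarrow> bool) \<Rightarrow> 'a set \<Rightarrow> 'a rel" where
  "coinitiality le A = cofinality (\<lambda>x y. le y x) A"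

lemma cofinality_least:
  assumes "\<And>a. a \<in> A \<Longrightarrow> le a a"
  obtains B where "cofinal_subset le A B" "cofinality le A = |B|"
    "\<And>C. cofinal_subset le A C \<Longrightarrow> |B| \<le>o |C|"
proof -
  let ?R = "card_of ` {B. cofinal_subset le A B}"
  have "cofinal_subset le A A"
    using assms by (auto simp: cofinal_subset_def)
  then have "?R \<noteq> {}" by blast
  moreover have "\<forall>r\<in>?R. Card_order r" by (auto simp: card_of_Card_order)
  ultimately have "\<exists>r\<in>?R. \<forall>r'\<in>?R. r \<le>o r'"
    by (rule exists_minim_Card_order)
  then have "\<exists>B. cofinal_subset le A B \<and> (\<forall>C. cofinal_subset le A C \<longrightarrow> |B| \<le>o |C| )"
    by auto
  from someI_ex[OF this] show ?thesis
    using that unfolding cofinality_def by blast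
qed


section \<open>Cuts in ordered sets\<close>

text \<open>
  Ordered sets are given by a carrier and a reflexive order relation, so that the same notions apply
  to an ordered group and to its quotients.
\<close>

type_synonym 'a cut = "'a set \<times> 'a set"

definition is_cut :: "'a set \<Rightarrow> ('a \<Rightarrow> 'a \<Rightarrow> bool) \<Rightarrow> 'a cut \<Rightarrow> bool" where
  "is_cut A le D \<longleftrightarrow>
    fst D \<union> snd D = A \<and> (\<forall>x\<in>fst D. \<forall>y\<in>snd D. le x y \<and> x \<noteq> y)"

definition proper_cut :: "'a cut \<Rightarrow> bool" where
  "proper_cut D \<longleftrightarrow> fst D \<noteq> {} \<and> snd D \<noteq> {}"

definition cut_above :: "'a set \<Rightarrow> ('a \<Rightarrow> 'a \<Rightarrow> bool) \<Rightarrow> 'a set \<Rightarrow> 'a cut" where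
  "cut_above A le M = (let L = {g \<in> A. \<exists>m\<in>M. le g m} in (L, A - L))"

definition cut_below :: "'a set \<Rightarrow> ('a \<Rightarrow> 'a \<Rightarrow> bool) \<Rightarrow> 'a set \<Rightarrow> 'a cut" where
  "cut_below A le M = (let L = {g \<in> A. \<forall>m\<in>M. le g m \<and> g \<noteq> m} in (L, A - L))"

definition principal_cut :: "'a set \<Rightarrow> ('a \<Rightarrow> 'a \<Rightarrow> bool) \<Rightarrow> 'a cut \<Rightarrow> bool" where
  "principal_cut A le D \<longleftrightarrow> (\<exists>c\<in>A. D = cut_above A le {c} \<or> D = cut_below A le {c})"

definition cut_cofinality :: "'a::linorder cut \<Rightarrow> 'a rel" where
  "cut_cofinality D = cofinality (\<le>) (fst D)"

definition cut_coinitiality :: "'a::linorder cut \<Rightarrow> 'a rel" where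
  "cut_coinitiality D = coinitiality (\<le>) (snd D)"


section \<open>Ball cuts in ordered abelian groups\<close>

definition invariance_group :: "'a::linordered_ab_group_add cut \<Rightarrow> 'a set" where
  "invariance_group D = {h. (\<lambda>x. x + h) ` fst D = fst D}"

definition coset :: "'a::ab_group_add \<Rightarrow> 'a set \<Rightarrow> 'a set" where
  "coset a H = (\<lambda>h. a + h) ` H"

definition quotient_image :: "'a::ab_group_add set \<Rightarrow> 'a set \<Rightarrow> 'a set set" where
  "quotient_image M H = (\<lambda>a. coset a H) ` M"

text \<open>For cosets of a convex subgroup this is the order of the quotient group.\<close>

definition coset_le :: "'a::linordered_ab_group_add set \<Rightarrow> 'a set \<Rightarrow> bool" where
  "coset_le X Y \<longleftrightarrow> (\<exists>x\<in>X. \<exists>y\<in>Y. x \<le> y)"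

definition ball_cut :: "'a::linordered_ab_group_add cut \<Rightarrow> bool" where
  "ball_cut D \<longleftrightarrow> (let H = invariance_group D in
    principal_cut (quotient_image UNIV H) coset_le (quotient_image (fst D) H, quotient_image (snd D) H))"

lemma mem_coset_iff: "x \<in> coset a H \<longleftrightarrow> x - a \<in> H"
  unfolding coset_def by (metis add_diff_cancel_left' diff_add_cancel image_iff)

lemma is_cut_snd: "is_cut UNIV (\<le>) D \<Longrightarrow> snd D = - fst D"
  unfolding is_cut_def by blast

lemma is_cut_downward:
  fixes D :: "'a::linorder cut"
  shows "is_cut UNIV (\<le>) D \<Longrightarrow> y \<in> fst D \<Longrightarrow> x \<le> y \<Longrightarrow> x \<in> fst D"
  unfolding is_cut_def by (metis UNIV_I Un_iff order_antisym)

lemma invariance_group_iff: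
  "h \<in> invariance_group D \<longleftrightarrow> (\<forall>x\<in>fst D. x + h \<in> fst D \<and> x - h \<in> fst D)"
proof
  assume "h \<in> invariance_group D"
  then have *: "(\<lambda>x. x + h) ` fst D = fst D"
    by (simp add: invariance_group_def)
  show "\<forall>x\<in>fst D. x + h \<in> fst D \<and> x - h \<in> fst D"
  proof
    fix x assume x: "x \<in> fst D"
    with * obtain y where "y \<in> fst D" "x = y + h" by blast
    with x * show "x + h \<in> fst D \<and> x - h \<in> fst D" by auto
  qed
next
  assume *: "\<forall>x\<in>fst D. x + h \<in> fst D \<and> x - h \<in> fst D"
  have "x \<in> (\<lambda>x. x + h) ` fst D" if "x \<in> fst D" for x
    using * that by (intro image_eqI[of _ _ "x - h"]) auto
  with * show "h \<in> invariance_group D"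
    by (auto simp: invariance_group_def)
qed

lemma invariance_group_zero: "0 \<in> invariance_group D"
  by (simp add: invariance_group_iff)

lemma invariance_group_minus: "h \<in> invariance_group D \<Longrightarrow> - h \<in> invariance_group D"
  by (simp add: invariance_group_iff)

lemma invariance_group_add:
  "g \<in> invariance_group D \<Longrightarrow> h \<in> invariance_group D \<Longrightarrow> g + h \<in> invariance_group D"
  unfolding invariance_group_iff by (metis add.assoc diff_diff_eq)

lemma invariance_group_convex:
  assumes "is_cut UNIV (\<le>) D" "a \<in> invariance_group D" "b \<in> invariance_group D" "a \<le> g" "g \<le> b"
  shows "g \<in> invariance_group D"
  unfolding invariance_group_iff
proof
  fix x assume x: "x \<in> fst D"
  have "x + b \<in> fst D" "x - a \<in> fst D"
    using assms x by (auto simp: invariance_group_iff)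
  then show "x + g \<in> fst D \<and> x - g \<in> fst D"
    using assms by (auto intro: is_cut_downward[OF assms(1)] add_left_mono diff_left_mono)
qed

text \<open>Ball cuts are the cuts given by the upper or lower edge of a coset of the invariance group.\<close>

lemma ball_cut_iff:
  assumes cut: "is_cut UNIV (\<le>) D"
  shows "ball_cut D \<longleftrightarrow> (\<exists>a. D = cut_above UNIV (\<le>) (coset a (invariance_group D)) \<or>
    D = cut_below UNIV (\<le>) (coset a (invariance_group D)))"
proof -
  define H where "H = invariance_group D"
  define q where "q = (\<lambda>a. coset a H)"
  note zero = invariance_group_zero[of D, folded H_def]
    and minus = invariance_group_minus[of _ D, folded H_def]
    and plus = invariance_group_add[of _ D, folded H_def]
    and convex = invariance_group_convex[OF cut, folded H_def]
  have q_eq: "q x = q y \<longleftrightarrow> x - y \<in> H" for x y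
  proof
    assume "q x = q y"
    moreover have "x \<in> q x" using zero by (simp add: q_def mem_coset_iff)
    ultimately show "x - y \<in> H" by (simp add: q_def mem_coset_iff)
  next
    assume h: "x - y \<in> H"
    have "z - x \<in> H \<longleftrightarrow> z - y \<in> H" for z
      using plus[OF _ h, of "z - x"] plus[OF _ minus[OF h], of "z - y"] by auto
    then show "q x = q y" by (auto simp: q_def mem_coset_iff)
  qed
  have q_le: "coset_le (q x) (q a) \<longleftrightarrow> (\<exists>m\<in>q a. x \<le> m)" for x a
  proof
    assume "coset_le (q x) (q a)"
    then obtain u v where uv: "u - x \<in> H" "v - a \<in> H" "u \<le> v"
      by (auto simp: coset_le_def q_def mem_coset_iff)
    have "(v - a) + - (u - x) \<in> H" using uv plus minus by blast
    then have "v - (u - x) \<in> q a" by (simp add: q_def mem_coset_iff algebra_simps)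
    moreover have "x \<le> v - (u - x)" using uv(3) by (simp add: algebra_simps)
    ultimately show "\<exists>m\<in>q a. x \<le> m" by blast
  next
    assume "\<exists>m\<in>q a. x \<le> m"
    moreover have "x \<in> q x" using zero by (simp add: q_def mem_coset_iff)
    ultimately show "coset_le (q x) (q a)" by (auto simp: coset_le_def)
  qed
  have q_less: "coset_le (q x) (q a) \<and> q x \<noteq> q a \<longleftrightarrow> (\<forall>m\<in>q a. x < m)" for x a
  proof
    assume *: "coset_le (q x) (q a) \<and> q x \<noteq> q a"
    then obtain m where "m \<in> q a" "x \<le> m"
      unfolding q_le by blast
    then have m: "m - a \<in> H" "x \<le> m"
      by (simp_all add: q_def mem_coset_iff)
    show "\<forall>m\<in>q a. x < m"
    proof (rule ccontr)
      assume "\<not> (\<forall>m\<in>q a. x < m)"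
      then obtain m' where m': "m' - a \<in> H" "m' \<le> x"
        by (auto simp: q_def mem_coset_iff not_less)
      have "x - a \<in> H"
        using convex[OF m'(1) m(1), of "x - a"] m m' by (simp add: diff_right_mono)
      with * show False by (simp add: q_eq)
    qed
  next
    assume *: "\<forall>m\<in>q a. x < m"
    have "a \<in> q a" using zero by (simp add: q_def mem_coset_iff)
    with * have "coset_le (q x) (q a)" by (auto simp: q_le intro: less_imp_le)
    moreover have "q x \<noteq> q a"
      using * zero by (force simp: q_eq q_def mem_coset_iff)
    ultimately show "coset_le (q x) (q a) \<and> q x \<noteq> q a" by blast
  qed
  have sat: "q x \<in> q ` fst D \<longleftrightarrow> x \<in> fst D" for x
  proof
    assume "q x \<in> q ` fst D"
    then obtain y where y: "y \<in> fst D" "x - y \<in> H" by (auto simp: q_eq)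
    then have "y + (x - y) \<in> fst D" unfolding H_def invariance_group_iff by blast
    then show "x \<in> fst D" by simp
  qed blast
  have D: "D = (L, UNIV - L) \<longleftrightarrow> fst D = L" for L
    using is_cut_snd[OF cut] by (auto simp: prod_eq_iff Compl_eq_Diff_UNIV)
  have "q ` snd D = range q - q ` fst D"
    unfolding is_cut_snd[OF cut] using sat by blast
  then have Q: "(q ` fst D, q ` snd D) = (L, range q - L) \<longleftrightarrow> q ` fst D = L" for L
    by (simp only: prod.inject) blast
  have img: "q ` fst D = {X \<in> range q. P X} \<longleftrightarrow> fst D = {x. P (q x)}" for P
  proof
    assume "q ` fst D = {X \<in> range q. P X}"
    then have "q x \<in> q ` fst D \<longleftrightarrow> P (q x)" for x by simp
    then show "fst D = {x. P (q x)}" unfolding sat by blast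
  qed auto
  have above: "(q ` fst D, q ` snd D) = cut_above (range q) coset_le {q a} \<longleftrightarrow>
      D = cut_above UNIV (\<le>) (q a)" for a
    unfolding cut_above_def Let_def Q D img by (simp add: q_le)
  have below: "(q ` fst D, q ` snd D) = cut_below (range q) coset_le {q a} \<longleftrightarrow>
      D = cut_below UNIV (\<le>) (q a)" for a
    unfolding cut_below_def Let_def Q D img by (simp add: q_less less_le[symmetric])
  have "ball_cut D \<longleftrightarrow> (\<exists>a. (q ` fst D, q ` snd D) = cut_above (range q) coset_le {q a} \<or>
      (q ` fst D, q ` snd D) = cut_below (range q) coset_le {q a})"
    unfolding ball_cut_def Let_def principal_cut_def quotient_image_def H_def[symmetric] q_def[symmetric]
    by blast
  then show ?thesis
    unfolding above below by (simp add: q_def H_def)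
qed


section \<open>Principal convex subgroups\<close>

definition principal_convex_subgroup ::
    "'a::{linordered_ab_group_add, ordered_ab_group_add_abs} \<Rightarrow> 'a set" where
  "principal_convex_subgroup a = {b. \<exists>n. \<bar>b\<bar> \<le> nsmul n \<bar>a\<bar>}"

text \<open>
  The index set \<open>I\<close> consists of the subgroups themselves, and its order is \<open>(\<supseteq>)\<close>: the smaller
  index is the larger subgroup.
\<close>

definition I_set :: "'a::{linordered_ab_group_add, ordered_ab_group_add_abs} set set" where
  "I_set = {principal_convex_subgroup a | a. a \<noteq> 0}"

definition Init_I :: "'a::{linordered_ab_group_add, ordered_ab_group_add_abs} set set set" where
  "Init_I = {S. S \<subseteq> I_set \<and> (\<forall>i\<in>S. \<forall>j\<in>I_set. j \<supseteq> i \<longrightarrow> j \<in> S)}"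

definition H_of :: "'a::{linordered_ab_group_add, ordered_ab_group_add_abs} set set \<Rightarrow> 'a set" where
  "H_of S = (if S = I_set then {0} else \<Union>(I_set - S))"

definition kappa_init :: "'a::{linordered_ab_group_add, ordered_ab_group_add_abs} set set \<Rightarrow> 'a set rel" where
  "kappa_init S = cofinality (\<supseteq>) S"

text \<open>By convention the coinitiality of the empty complement is the cardinal one.\<close>

definition lambda_init :: "'a::{linordered_ab_group_add, ordered_ab_group_add_abs} set set \<Rightarrow> 'a set rel" where
  "lambda_init S = (if S = I_set then |{{}}| else coinitiality (\<supseteq>) (I_set - S))"

definition has_max :: "'a set set \<Rightarrow> bool" where
  "has_max S \<longleftrightarrow> (\<exists>m\<in>S. \<forall>i\<in>S. i \<supseteq> m)"

definition has_min :: "'a set set \<Rightarrow> bool" where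
  "has_min T \<longleftrightarrow> (\<exists>m\<in>T. \<forall>i\<in>T. m \<supseteq> i)"


section \<open>Subtypes of ball cuts\<close>

datatype sign = Pos_sign (\<open>\<oplus>\<close>) | Neg_sign (\<open>\<ominus>\<close>)

definition has_subtype :: "'a::{linordered_ab_group_add, ordered_ab_group_add_abs} cut \<Rightarrow> 'a set set
    \<Rightarrow> sign \<times> sign \<times> sign \<Rightarrow> bool" where
  "has_subtype D S = (\<lambda>(s1, s2, s3).
    (case s1 of
      \<oplus> \<Rightarrow> \<exists>a. D = cut_above UNIV (\<le>) (coset a (H_of S))
    | \<ominus> \<Rightarrow> \<exists>a. D = cut_below UNIV (\<le>) (coset a (H_of S))) \<and>
    s2 = (if has_max S then \<oplus> else \<ominus>) \<and>
    s3 = (if has_min (I_set - S) then \<oplus> else \<ominus>))"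

lemma ball_cut_has_subtype:
  assumes "is_cut UNIV (\<le>) D" "ball_cut D" "H_of S = invariance_group D"
  shows "\<exists>t. has_subtype D S t"
proof -
  let ?s2 = "if has_max S then \<oplus> else \<ominus>" and ?s3 = "if has_min (I_set - S) then \<oplus> else \<ominus>"
  have "has_subtype D S (\<oplus>, ?s2, ?s3) \<or> has_subtype D S (\<ominus>, ?s2, ?s3)"
    using ball_cut_iff[OF assms(1)] assms(2,3) by (auto simp: has_subtype_def)
  then show ?thesis
    by (elim disjE) (rule exI, assumption)+
qed

end

theory Submission
  imports Defs
begin

text \<open>
  Let \<open>H = H\<^sub>S\<close>, and let \<open>U\<close> be the set of elements lying above all of \<open>H\<close>. After a translation, and
  for \<open>D = (a + H)\<^sup>-\<close> a reflection, one side of a ball cut is the closure of \<open>H\<close> under passing to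
  smaller elements and the other side is \<open>U\<close>. So \<open>\<kappa>(D)\<close> and \<open>\<lambda>(D)\<close> are, in an order that depends
  on the first sign, the cofinality of \<open>H\<close> and the coinitiality of \<open>U\<close>.

  A nonzero \<open>g\<close> lies in \<open>H\<close> iff its principal convex subgroup has its index in \<open>S\<^sup>c\<close>, and a positive
  \<open>g\<close> lies in \<open>U\<close> iff that index is in \<open>S\<close> (\<open>mem_H_of_iff\<close>, \<open>elements_above_H_of_iff\<close>). Pick a
  positive generator \<open>c\<^sub>i\<close> of each \<open>H\<^sub>i\<close>; the larger the index, the smaller the generator. If \<open>S\<^sup>c\<close>
  is nonempty without minimum, the \<open>c\<^sub>i\<close> with \<open>i \<in> S\<^sup>c\<close> are cofinal in \<open>H\<close>, because every element
  of \<open>H\<close> is exceeded by the generator of some larger \<open>H\<^sub>i\<close>; so the cofinality of \<open>H\<close> is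
  \<open>\<lambda>(S)\<close>. If \<open>S\<^sup>c\<close> has a minimum \<open>i\<close>, then \<open>H = H\<^sub>i\<close> and the multiples \<open>n c\<^sub>i\<close> are cofinal.
  If \<open>S\<^sup>c\<close> is empty, then \<open>H = {0}\<close> has cofinality one, in accordance with the convention for \<open>\<lambda>(S)\<close>.
  Likewise, if \<open>S\<close> has no maximum, the \<open>c\<^sub>i\<close> with \<open>i \<in> S\<close> are coinitial in \<open>U\<close>, which gives
  \<open>\<kappa>(S)\<close>; and if \<open>S\<close> has a maximum \<open>i\<close>, then the fractions \<open>c\<^sub>i / n\<close>, which exist by
  divisibility, are coinitial in \<open>U\<close>.

  All these comparisons exhibit an order embedding with cofinal image, for the order or its reverse,
  and such an embedding preserves the cofinality (\<open>cofinality_cofinal_embedding\<close>).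
\<close>

section \<open>Cofinality and cofinal embeddings\<close>

text \<open>
  The image of a cofinal set is again cofinal. Conversely, replacing each element of a cofinal subset
  of \<open>B\<close> by some element of \<open>A\<close> whose image dominates it gives a cofinal subset of \<open>A\<close>, since the
  embedding reflects the order.
\<close>

lemma cofinality_cofinal_embedding:
  assumes refl: "reflp le'" and trans: "transp le'"
    and into: "\<And>x. x \<in> A \<Longrightarrow> \<phi> x \<in> B"
    and emb: "\<And>x y. x \<in> A \<Longrightarrow> y \<in> A \<Longrightarrow> le x y \<longleftrightarrow> le' (\<phi> x) (\<phi> y)"
    and cof: "\<And>b. b \<in> B \<Longrightarrow> \<exists>x\<in>A. le' b (\<phi> x)"
  shows "cofinality le A =o cofinality le' B"
proof -
  have reflA: "le x x" if "x \<in> A" for x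
    using emb[OF that that] refl by (auto simp: reflp_def)
  obtain X where X: "cofinal_subset le A X" "cofinality le A = |X|"
    "\<And>Y. cofinal_subset le A Y \<Longrightarrow> |X| \<le>o |Y|"
    using cofinality_least[of A le] reflA by blast
  obtain Z where Z: "cofinal_subset le' B Z" "cofinality le' B = |Z|"
    "\<And>Y. cofinal_subset le' B Y \<Longrightarrow> |Z| \<le>o |Y|"
    using cofinality_least[of B le'] refl by (auto simp: reflp_def)
  have "cofinal_subset le' B (\<phi> ` X)"
    unfolding cofinal_subset_def
  proof (intro conjI ballI)
    show "\<phi> ` X \<subseteq> B"
      using X(1) into by (auto simp: cofinal_subset_def)
    fix b assume "b \<in> B"
    then obtain x where x: "x \<in> A" "le' b (\<phi> x)"
      using cof by blast
    then obtain y where y: "y \<in> X" "le x y" "y \<in> A"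
      using X(1) unfolding cofinal_subset_def by blast
    then have "le' (\<phi> x) (\<phi> y)"
      using emb x by blast
    then show "\<exists>c\<in>\<phi> ` X. le' b c"
      using x y transpD[OF trans] by blast
  qed
  then have ZX: "|Z| \<le>o |X|"
    using Z(3) card_of_image ordLeq_transitive by blast
  obtain \<psi> where \<psi>: "\<And>b. b \<in> B \<Longrightarrow> \<psi> b \<in> A \<and> le' b (\<phi> (\<psi> b))"
    using cof by metis
  have "cofinal_subset le A (\<psi> ` Z)"
    unfolding cofinal_subset_def
  proof (intro conjI ballI)
    show "\<psi> ` Z \<subseteq> A"
      using Z(1) \<psi> by (auto simp: cofinal_subset_def)
    fix x assume x: "x \<in> A"
    then obtain z where z: "z \<in> Z" "le' (\<phi> x) z" "z \<in> B"
      using Z(1) into unfolding cofinal_subset_def by blast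
    then have "le' (\<phi> x) (\<phi> (\<psi> z))"
      using \<psi> transpD[OF trans] by blast
    then have "le x (\<psi> z)"
      using emb x \<psi> z by blast
    then show "\<exists>c\<in>\<psi> ` Z. le x c"
      using z by blast
  qed
  then have "|X| \<le>o |Z|"
    using X(3) card_of_image ordLeq_transitive by blast
  with ZX show ?thesis
    using X(2) Z(2) by (simp add: ordIso_iff_ordLeq)
qed

lemma cofinality_nat: "cofinality (\<le>) (UNIV :: nat set) =o natLeq"
proof -
  obtain X where X: "cofinal_subset (\<le>) (UNIV :: nat set) X"
    "cofinality (\<le>) (UNIV :: nat set) = |X|"
    using cofinality_least[of "UNIV :: nat set" "(\<le>)"] by blast
  have "infinite X"
  proof
    assume "finite X"
    moreover obtain x where "x \<in> X" "Suc (Max X) \<le> x"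
      using X(1) unfolding cofinal_subset_def by blast
    ultimately show False
      using Max_ge[of X x] by (simp del: Max_ge)
  qed
  then have "natLeq \<le>o |X|"
    using infinite_iff_natLeq_ordLeq by blast
  moreover have "|X| \<le>o natLeq"
    using card_of_mono1[of X UNIV] card_of_nat ordLeq_ordIso_trans by blast
  ultimately show ?thesis
    using X(2) by (simp add: ordIso_iff_ordLeq)
qed

lemma cofinality_singleton:
  assumes "le a a"
  shows "cofinality le {a} =o |{b}|"
proof -
  obtain X where X: "cofinal_subset le {a} X" "cofinality le {a} = |X|"
    using cofinality_least[of "{a}" le] assms by blast
  then have "X = {a}"
    by (auto simp: cofinal_subset_def)
  then show ?thesis
    using X(2) card_of_singl_ordLeq[of "{a}" b] card_of_singl_ordLeq[of "{b}" a]
    by (simp add: ordIso_iff_ordLeq)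
qed


section \<open>Principal convex subgroups and the convex subgroup of an initial segment\<close>

lemma nsmul_nonneg: "0 \<le> a \<Longrightarrow> 0 \<le> nsmul n (a :: 'a::linordered_ab_group_add)"
  using nsmul_mono[of 0 a n] by simp

lemma nsmul_less_left:
  fixes a :: "'a::linordered_ab_group_add"
  assumes "0 < a" "m < n"
  shows "nsmul m a < nsmul n a"
proof -
  have "nsmul n a = nsmul (n - m) a + nsmul m a"
    using assms by (simp flip: nsmul_add_left)
  moreover have "0 < nsmul (n - m) a"
    using nsmul_strict_mono[of 0 a "n - m"] assms by simp
  ultimately show ?thesis by simp
qed

context
  fixes a b :: "'a::{linordered_ab_group_add, ordered_ab_group_add_abs}"
begin

lemma principal_convex_subgroup_self: "a \<in> principal_convex_subgroup a"
  unfolding principal_convex_subgroup_def by (auto intro: exI[of _ 1])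

lemma principal_convex_subgroup_subset_iff:
  "principal_convex_subgroup a \<subseteq> principal_convex_subgroup b \<longleftrightarrow> a \<in> principal_convex_subgroup b"
proof
  assume "a \<in> principal_convex_subgroup b"
  then obtain n where n: "\<bar>a\<bar> \<le> nsmul n \<bar>b\<bar>"
    by (auto simp: principal_convex_subgroup_def)
  have "\<bar>x\<bar> \<le> nsmul (m * n) \<bar>b\<bar>" if "\<bar>x\<bar> \<le> nsmul m \<bar>a\<bar>" for x m
    using that nsmul_mono[OF n, of m] by (simp add: nsmul_mult)
  then show "principal_convex_subgroup a \<subseteq> principal_convex_subgroup b"
    by (auto simp: principal_convex_subgroup_def)
qed (use principal_convex_subgroup_self in blast)

lemma principal_convex_subgroup_mono:
  assumes "0 \<le> a" "a \<le> b"
  shows "principal_convex_subgroup a \<subseteq> principal_convex_subgroup b"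
  unfolding principal_convex_subgroup_subset_iff
  unfolding principal_convex_subgroup_def using assms by (auto intro!: exI[of _ 1])

end

definition pos_generator :: "'a::{linordered_ab_group_add, ordered_ab_group_add_abs} set \<Rightarrow> 'a" where
  "pos_generator i = (SOME c. 0 < c \<and> i = principal_convex_subgroup c)"

lemma pos_generator:
  fixes i :: "'a::{linordered_ab_group_add, ordered_ab_group_add_abs} set"
  assumes "i \<in> I_set"
  shows "0 < pos_generator i" "principal_convex_subgroup (pos_generator i) = i"
proof -
  obtain a where a: "a \<noteq> 0" "i = principal_convex_subgroup a"
    using assms by (auto simp: I_set_def)
  have "0 < \<bar>a\<bar> \<and> i = principal_convex_subgroup \<bar>a\<bar>"
    using a by (simp add: principal_convex_subgroup_def)
  then have "0 < pos_generator i \<and> i = principal_convex_subgroup (pos_generator i)"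
    unfolding pos_generator_def by (rule someI)
  then show "0 < pos_generator i" "principal_convex_subgroup (pos_generator i) = i"
    by auto
qed

text \<open>
  Although the generators are chosen arbitrarily, they are ordered like the subgroups: one generator
  lies below another as soon as its subgroup is strictly smaller, and equal subgroups have the same
  chosen generator.
\<close>

lemma pos_generator_le_iff:
  assumes "i \<in> I_set" "j \<in> I_set"
  shows "pos_generator i \<le> pos_generator j \<longleftrightarrow> i \<subseteq> j"
proof
  assume "pos_generator i \<le> pos_generator j"
  then show "i \<subseteq> j"
    using principal_convex_subgroup_mono[of "pos_generator i" "pos_generator j"]
      pos_generator[OF assms(1)] pos_generator[OF assms(2)] by simp
next
  assume "i \<subseteq> j"
  show "pos_generator i \<le> pos_generator j"
  proof (rule ccontr)
    assume less: "\<not> pos_generator i \<le> pos_generator j"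
    then have "j \<subseteq> i"
      using principal_convex_subgroup_mono[of "pos_generator j" "pos_generator i"]
        pos_generator[OF assms(1)] pos_generator[OF assms(2)] by simp
    with \<open>i \<subseteq> j\<close> less show False by auto
  qed
qed

lemma pos_generator_less:
  assumes "i \<in> I_set" "0 < g" "\<not> principal_convex_subgroup g \<subseteq> i"
  shows "pos_generator i < g"
proof (rule ccontr)
  assume "\<not> pos_generator i < g"
  then have "principal_convex_subgroup g \<subseteq> i"
    using principal_convex_subgroup_mono[of g "pos_generator i"] assms(2) pos_generator[OF assms(1)]
    by simp
  with assms(3) show False ..
qed

lemma less_pos_generator:
  assumes "i \<in> I_set" "\<not> i \<subseteq> principal_convex_subgroup g"
  shows "g < pos_generator i"
proof (rule ccontr)
  assume "\<not> g < pos_generator i"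
  then have "i \<subseteq> principal_convex_subgroup g"
    using principal_convex_subgroup_mono[of "pos_generator i" g] pos_generator[OF assms(1)] by simp
  with assms(2) show False ..
qed

lemma principal_convex_subgroup_in_I_set: "a \<noteq> 0 \<Longrightarrow> principal_convex_subgroup a \<in> I_set"
  by (auto simp: I_set_def)

lemma Init_I_superset: "S \<in> Init_I \<Longrightarrow> i \<in> S \<Longrightarrow> j \<in> I_set \<Longrightarrow> i \<subseteq> j \<Longrightarrow> j \<in> S"
  by (auto simp: Init_I_def)

text \<open>
  If the subgroup of \<open>g\<close> is contained in one with index outside \<open>S\<close>, its own index is no smaller
  and hence also outside the initial segment \<open>S\<close>.
\<close>

lemma mem_H_of_iff:
  assumes S: "S \<in> Init_I" and "g \<noteq> 0"
  shows "g \<in> H_of S \<longleftrightarrow> principal_convex_subgroup g \<notin> S"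
proof
  assume "principal_convex_subgroup g \<notin> S"
  then show "g \<in> H_of S"
    using principal_convex_subgroup_in_I_set[OF \<open>g \<noteq> 0\<close>] principal_convex_subgroup_self[of g]
    by (auto simp: H_of_def)
next
  assume "g \<in> H_of S"
  then obtain c where c: "c \<noteq> 0" "principal_convex_subgroup c \<notin> S" "g \<in> principal_convex_subgroup c"
    using \<open>g \<noteq> 0\<close> by (auto simp: H_of_def I_set_def split: if_splits)
  then show "principal_convex_subgroup g \<notin> S"
    using Init_I_superset[OF S _ principal_convex_subgroup_in_I_set[OF c(1)]]
      principal_convex_subgroup_subset_iff[of g c] by blast
qed

lemma zero_mem_H_of:
  assumes "S \<in> Init_I"
  shows "0 \<in> H_of S"
proof (cases "S = I_set")
  case False
  then obtain a where "principal_convex_subgroup a \<in> I_set - S"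
    using assms by (auto simp: Init_I_def I_set_def)
  moreover have "0 \<in> principal_convex_subgroup a"
    by (auto simp: principal_convex_subgroup_def intro: exI[of _ 0])
  ultimately show ?thesis
    using False by (auto simp: H_of_def)
qed (simp add: H_of_def)

lemma uminus_mem_H_of: "h \<in> H_of S \<Longrightarrow> - h \<in> H_of S"
proof (cases "S = I_set")
  case False
  have "- h \<in> i" if "h \<in> i" "i \<in> I_set" for i
    using that by (auto simp: I_set_def principal_convex_subgroup_def)
  moreover assume "h \<in> H_of S"
  ultimately show ?thesis
    using False unfolding H_of_def by auto
qed (simp add: H_of_def)

definition elements_above :: "'a::ord set \<Rightarrow> 'a set" where
  "elements_above M = {g. \<forall>m\<in>M. m < g}"

lemma elements_above_H_of_iff:
  assumes S: "S \<in> Init_I"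
  shows "g \<in> elements_above (H_of S) \<longleftrightarrow> 0 < g \<and> principal_convex_subgroup g \<in> S"
proof
  assume g: "g \<in> elements_above (H_of S)"
  then have "0 < g" "g \<notin> H_of S"
    using zero_mem_H_of[OF S] by (auto simp: elements_above_def)
  then show "0 < g \<and> principal_convex_subgroup g \<in> S"
    using mem_H_of_iff[OF S, of g] by simp
next
  assume g: "0 < g \<and> principal_convex_subgroup g \<in> S"
  have "h < g" if h: "h \<in> H_of S" for h
  proof (rule ccontr)
    assume "\<not> h < g"
    with g have "h \<noteq> 0" and "principal_convex_subgroup g \<subseteq> principal_convex_subgroup h"
      using principal_convex_subgroup_mono[of g h] by (auto simp: not_less less_imp_le)
    with g have "principal_convex_subgroup h \<in> S"
      using Init_I_superset[OF S] principal_convex_subgroup_in_I_set by blast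
    then show False
      using mem_H_of_iff[OF S \<open>h \<noteq> 0\<close>] h by simp
  qed
  then show "g \<in> elements_above (H_of S)"
    by (simp add: elements_above_def)
qed

lemma reflp_transp_orders:
  "reflp ((\<le>) :: 'a::preorder \<Rightarrow> _)" "transp ((\<le>) :: 'a \<Rightarrow> _)"
  "reflp (\<lambda>x y :: 'a. y \<le> x)" "transp (\<lambda>x y :: 'a. y \<le> x)"
  by (auto simp: reflp_def transp_def intro: order_trans)


section \<open>The cofinality of the convex subgroup\<close>

lemma cofinality_H_of_has_min:
  assumes S: "S \<in> Init_I" and min: "has_min (I_set - S)"
  shows "cofinality (\<le>) (H_of S) =o natLeq"
proof -
  obtain m where m: "m \<in> I_set" "m \<notin> S" "\<And>i. i \<in> I_set \<Longrightarrow> i \<notin> S \<Longrightarrow> i \<subseteq> m"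
    using min by (auto simp: has_min_def)
  then have Hm: "H_of S = m"
    by (auto simp: H_of_def)
  define c where "c = pos_generator m"
  have c: "0 < c" "m = principal_convex_subgroup c"
    using pos_generator[OF m(1)] by (simp_all add: c_def)
  have "cofinality (\<le>) (UNIV :: nat set) =o cofinality (\<le>) (H_of S)"
  proof (rule cofinality_cofinal_embedding[OF reflp_transp_orders(1,2)])
    show "nsmul n c \<in> H_of S" for n
      using c nsmul_nonneg[of c n] by (auto simp: Hm principal_convex_subgroup_def)
    show "n \<le> k \<longleftrightarrow> nsmul n c \<le> nsmul k c" for n k
      using nsmul_less_left[OF c(1)] by (metis less_imp_le linorder_not_le order_refl le_less)
    show "\<exists>n\<in>UNIV. h \<le> nsmul n c" if "h \<in> H_of S" for h
      using that c by (auto simp: Hm principal_convex_subgroup_def intro: order_trans[OF abs_ge_self])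
  qed
  then show ?thesis
    using cofinality_nat ordIso_symmetric ordIso_transitive by blast
qed

text \<open>
  For \<open>S = I\<close> the subgroup is trivial, and its cofinality is the cardinal one that is the
  conventional value of \<open>\<lambda>(S)\<close>.
\<close>

lemma cofinality_H_of_no_min:
  assumes S: "S \<in> Init_I" and no_min: "\<not> has_min (I_set - S)"
  shows "cofinality (\<le>) (H_of S) =o lambda_init S"
proof (cases "S = I_set")
  case True
  then show ?thesis
    by (simp add: H_of_def lambda_init_def cofinality_singleton)
next
  case False
  then obtain i0 where i0: "i0 \<in> I_set - S"
    using S by (auto simp: Init_I_def)
  have "cofinality (\<lambda>x y. x \<subseteq> y) (I_set - S) =o cofinality (\<le>) (H_of S)"
  proof (rule cofinality_cofinal_embedding[OF reflp_transp_orders(1,2)])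
    show "pos_generator i \<in> H_of S" if "i \<in> I_set - S" for i
      using that pos_generator[of i] mem_H_of_iff[OF S, of "pos_generator i"] by auto
    show "i \<subseteq> j \<longleftrightarrow> pos_generator i \<le> pos_generator j" if "i \<in> I_set - S" "j \<in> I_set - S" for i j
      using that by (simp add: pos_generator_le_iff)
    show "\<exists>i\<in>I_set - S. h \<le> pos_generator i" if h: "h \<in> H_of S" for h
    proof (cases "0 < h")
      case True
      then have "principal_convex_subgroup h \<in> I_set - S"
        using h mem_H_of_iff[OF S, of h] principal_convex_subgroup_in_I_set[of h] by simp
      then obtain i where "i \<in> I_set - S" "\<not> i \<subseteq> principal_convex_subgroup h"
        using no_min unfolding has_min_def by blast
      then show ?thesis
        using less_pos_generator[of i h] by (auto intro: less_imp_le)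
    next
      case False
      then show ?thesis
        using i0 pos_generator(1)[of i0] by (intro bexI[of _ i0]) auto
    qed
  qed
  then show ?thesis
    using False ordIso_symmetric by (auto simp: lambda_init_def coinitiality_def)
qed


section \<open>The coinitiality of the set of elements above the convex subgroup\<close>

text \<open>
  The fractions \<open>c / (n + 1)\<close> of a generator \<open>c\<close> of the least convex subgroup properly containing
  \<open>H\<^sub>S\<close> still generate that subgroup, so they stay above \<open>H\<^sub>S\<close>. They are coinitial since \<open>c \<le> n g\<close>
  for some \<open>n\<close> whenever \<open>g\<close> generates a subgroup containing \<open>c\<close>.
\<close>

lemma coinitiality_elements_above_has_max:
  fixes S :: "'a::{linordered_ab_group_add, ordered_ab_group_add_abs} set set"
  assumes divisible: "\<And>n (x :: 'a). n > 0 \<Longrightarrow> \<exists>y. nsmul n y = x"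
    and S: "S \<in> Init_I" and max: "has_max S"
  shows "coinitiality (\<le>) (elements_above (H_of S)) =o natLeq"
proof -
  obtain m where m: "m \<in> S" "\<And>i. i \<in> S \<Longrightarrow> m \<subseteq> i"
    using max by (auto simp: has_max_def)
  then have mI: "m \<in> I_set"
    using S by (auto simp: Init_I_def)
  define c where "c = pos_generator m"
  have c: "0 < c" "m = principal_convex_subgroup c"
    using pos_generator[OF mI] by (simp_all add: c_def)
  obtain s where s: "\<And>n. nsmul (Suc n) (s n) = c"
    using divisible[of "Suc n" c for n] by (metis zero_less_Suc)
  have s_pos: "0 < s n" for n
  proof (rule ccontr)
    assume "\<not> 0 < s n"
    then have "nsmul (Suc n) (s n) \<le> nsmul (Suc n) 0"
      by (intro nsmul_mono) simp
    then show False
      using c(1) s by simp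
  qed
  have s_less: "s k < s n" if "n < k" for n k
  proof (rule ccontr)
    assume "\<not> s k < s n"
    then have "nsmul (Suc k) (s n) \<le> nsmul (Suc k) (s k)"
      by (intro nsmul_mono) simp
    moreover have "nsmul (Suc n) (s n) < nsmul (Suc k) (s n)"
      using that by (intro nsmul_less_left s_pos) simp
    ultimately show False
      unfolding s by simp
  qed
  have "cofinality (\<le>) (UNIV :: nat set) =o cofinality (\<lambda>x y. y \<le> x) (elements_above (H_of S))"
  proof (rule cofinality_cofinal_embedding[OF reflp_transp_orders(3,4)])
    show "s n \<in> elements_above (H_of S)" for n
    proof -
      have "\<bar>c\<bar> \<le> nsmul (Suc n) \<bar>s n\<bar>"
        using c(1) s_pos[of n] s[of n] by (simp del: nsmul.simps)
      then have "c \<in> principal_convex_subgroup (s n)"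
        unfolding principal_convex_subgroup_def by blast
      then have "m \<subseteq> principal_convex_subgroup (s n)"
        by (simp add: c(2) principal_convex_subgroup_subset_iff)
      then have "principal_convex_subgroup (s n) \<in> S"
        using Init_I_superset[OF S m(1)] s_pos[of n] principal_convex_subgroup_in_I_set[of "s n"]
        by simp
      then show ?thesis
        using elements_above_H_of_iff[OF S] s_pos by blast
    qed
    show "n \<le> k \<longleftrightarrow> s k \<le> s n" for n k
      using s_less by (metis less_imp_le linorder_not_le le_less)
    show "\<exists>n\<in>UNIV. s n \<le> g" if "g \<in> elements_above (H_of S)" for g
    proof -
      have g: "0 < g" "principal_convex_subgroup g \<in> S"
        using that elements_above_H_of_iff[OF S] by auto
      then have "c \<in> principal_convex_subgroup g"
        using m(2) c(2) principal_convex_subgroup_self by blast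
      then obtain n where "c \<le> nsmul n g"
        using c(1) g(1) by (auto simp: principal_convex_subgroup_def)
      also have "\<dots> \<le> nsmul (Suc n) g"
        using g(1) by simp
      finally have "nsmul (Suc n) (s n) \<le> nsmul (Suc n) g"
        unfolding s .
      then show ?thesis
        using nsmul_le_iff[of "Suc n" "s n" g] by blast
    qed
  qed
  then show ?thesis
    unfolding coinitiality_def using cofinality_nat ordIso_symmetric ordIso_transitive by blast
qed

lemma coinitiality_elements_above_no_max:
  assumes S: "S \<in> Init_I" and no_max: "\<not> has_max S"
  shows "coinitiality (\<le>) (elements_above (H_of S)) =o kappa_init S"
proof -
  have SI: "i \<in> I_set" if "i \<in> S" for i
    using S that by (auto simp: Init_I_def)
  have "cofinality (\<supseteq>) S =o cofinality (\<lambda>x y. y \<le> x) (elements_above (H_of S))"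
  proof (rule cofinality_cofinal_embedding[OF reflp_transp_orders(3,4)])
    show "pos_generator i \<in> elements_above (H_of S)" if "i \<in> S" for i
      using that SI pos_generator[of i] by (simp add: elements_above_H_of_iff[OF S])
    show "j \<subseteq> i \<longleftrightarrow> pos_generator j \<le> pos_generator i" if "i \<in> S" "j \<in> S" for i j
      using that SI by (simp add: pos_generator_le_iff)
    show "\<exists>i\<in>S. pos_generator i \<le> g" if "g \<in> elements_above (H_of S)" for g
    proof -
      have g: "0 < g" "principal_convex_subgroup g \<in> S"
        using that elements_above_H_of_iff[OF S] by auto
      then obtain i where "i \<in> S" "\<not> principal_convex_subgroup g \<subseteq> i"
        using no_max unfolding has_max_def by blast
      then show ?thesis
        using pos_generator_less[of i g] g(1) SI by (auto intro: less_imp_le)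
    qed
  qed
  then show ?thesis
    unfolding coinitiality_def kappa_init_def by (rule ordIso_symmetric)
qed


section \<open>The two sides of a ball cut\<close>

lemma cut_cofinality_above_coset:
  fixes a :: "'a::linordered_ab_group_add"
  shows "cut_cofinality (cut_above UNIV (\<le>) (coset a H)) =o cofinality (\<le>) H"
proof -
  have "cofinality (\<le>) H =o cofinality (\<le>) {g. \<exists>m\<in>coset a H. g \<le> m}"
    by (rule cofinality_cofinal_embedding[OF reflp_transp_orders(1,2), where \<phi> = "\<lambda>h. a + h"])
      (auto simp: coset_def)
  then show ?thesis
    by (simp add: cut_cofinality_def cut_above_def Let_def ordIso_symmetric)
qed

lemma cut_coinitiality_above_coset:
  fixes a :: "'a::linordered_ab_group_add"
  shows "cut_coinitiality (cut_above UNIV (\<le>) (coset a H)) =o coinitiality (\<le>) (elements_above H)"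
proof -
  have "cofinality (\<lambda>x y. y \<le> x) (elements_above H)
      =o cofinality (\<lambda>x y. y \<le> x) (UNIV - {g. \<exists>m\<in>coset a H. g \<le> m})"
  proof (rule cofinality_cofinal_embedding[OF reflp_transp_orders(3,4), where \<phi> = "\<lambda>u. a + u"])
    show "\<exists>u\<in>elements_above H. a + u \<le> b" if "b \<in> UNIV - {g. \<exists>m\<in>coset a H. g \<le> m}" for b
      using that by (intro bexI[of _ "b - a"])
        (auto simp: coset_def elements_above_def not_le less_diff_eq add.commute)
  qed (auto simp: coset_def elements_above_def not_le)
  then show ?thesis
    by (simp add: cut_coinitiality_def coinitiality_def cut_above_def Let_def ordIso_symmetric)
qed

text \<open>
  A subset closed under negation has its lower edge described by the reflection \<open>h \<mapsto> a - h\<close>, which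
  exchanges cofinal and coinitial sets.
\<close>

lemma cut_coinitiality_below_coset:
  fixes a :: "'a::linordered_ab_group_add"
  assumes minus: "\<And>h. h \<in> H \<Longrightarrow> - h \<in> H"
  shows "cut_coinitiality (cut_below UNIV (\<le>) (coset a H)) =o cofinality (\<le>) H"
proof -
  have "cofinality (\<le>) H
      =o cofinality (\<lambda>x y. y \<le> x) (UNIV - {g. \<forall>m\<in>coset a H. g \<le> m \<and> g \<noteq> m})"
  proof (rule cofinality_cofinal_embedding[OF reflp_transp_orders(3,4), where \<phi> = "\<lambda>h. a - h"])
    show "a - h \<in> UNIV - {g. \<forall>m\<in>coset a H. g \<le> m \<and> g \<noteq> m}" if "h \<in> H" for h
      using minus[OF that] by (auto simp: coset_def intro!: bexI[of _ "- h"])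
    show "\<exists>h\<in>H. a - h \<le> b" if b: "b \<in> UNIV - {g. \<forall>m\<in>coset a H. g \<le> m \<and> g \<noteq> m}" for b
    proof -
      obtain m where "m \<in> coset a H" "\<not> (b \<le> m \<and> b \<noteq> m)"
        using b by blast
      then obtain h where "h \<in> H" "a + h \<le> b"
        by (metis coset_def imageE linear order_refl)
      then show ?thesis
        using minus by (intro bexI[of _ "- h"]) auto
    qed
  qed auto
  then show ?thesis
    by (simp add: cut_coinitiality_def coinitiality_def cut_below_def Let_def ordIso_symmetric)
qed

lemma cut_cofinality_below_coset:
  fixes a :: "'a::linordered_ab_group_add"
  assumes minus: "\<And>h. h \<in> H \<Longrightarrow> - h \<in> H"
  shows "cut_cofinality (cut_below UNIV (\<le>) (coset a H)) =o coinitiality (\<le>) (elements_above H)"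
proof -
  have "cofinality (\<lambda>x y. y \<le> x) (elements_above H)
      =o cofinality (\<le>) {g. \<forall>m\<in>coset a H. g \<le> m \<and> g \<noteq> m}"
  proof (rule cofinality_cofinal_embedding[OF reflp_transp_orders(1,2), where \<phi> = "\<lambda>u. a - u"])
    show "a - u \<in> {g. \<forall>m\<in>coset a H. g \<le> m \<and> g \<noteq> m}" if "u \<in> elements_above H" for u
    proof -
      have "a - u < a + h" if "h \<in> H" for h
      proof -
        have "- h < u"
          using \<open>u \<in> elements_above H\<close> minus[OF that] by (simp add: elements_above_def)
        then have "- u < h"
          by (simp add: minus_less_iff)
        then show ?thesis
          using add_strict_left_mono[of "- u" h a] by simp
      qed
      then show ?thesis
        by (auto simp: coset_def less_le)
    qed
    show "\<exists>u\<in>elements_above H. b \<le> a - u" if "b \<in> {g. \<forall>m\<in>coset a H. g \<le> m \<and> g \<noteq> m}" for b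
    proof (intro bexI[of _ "a - b"])
      have "h < a - b" if "h \<in> H" for h
      proof -
        have "b < a - h"
          using \<open>b \<in> {g. \<forall>m\<in>coset a H. g \<le> m \<and> g \<noteq> m}\<close> minus[OF that]
          by (simp add: coset_def flip: less_le) (metis add_uminus_conv_diff)
        then show ?thesis
          by (simp add: less_diff_eq add.commute)
      qed
      then show "a - b \<in> elements_above H"
        by (simp add: elements_above_def)
    qed simp
  qed auto
  then show ?thesis
    by (simp add: cut_cofinality_def coinitiality_def cut_below_def Let_def ordIso_symmetric)
qed

theorem theorem4p8:
  fixes D :: "'g::linordered_ab_group_add div_hull cut"
    and S :: "'g div_hull set set"
  assumes "is_cut UNIV (\<le>) D"
    and "proper_cut D"
    and "ball_cut D"
    and "S \<in> Init_I"
    and "H_of S = invariance_group D"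
  shows
   "(has_subtype D S (\<oplus>, \<oplus>, \<oplus>) \<longrightarrow>
      cut_cofinality D =o natLeq \<and> cut_coinitiality D =o natLeq) \<and>
    (has_subtype D S (\<oplus>, \<oplus>, \<ominus>) \<longrightarrow>
      cut_cofinality D =o lambda_init S \<and> cut_coinitiality D =o natLeq) \<and>
    (has_subtype D S (\<oplus>, \<ominus>, \<oplus>) \<longrightarrow>
      cut_cofinality D =o natLeq \<and> cut_coinitiality D =o kappa_init S) \<and>
    (has_subtype D S (\<oplus>, \<ominus>, \<ominus>) \<longrightarrow>
      cut_cofinality D =o lambda_init S \<and> cut_coinitiality D =o kappa_init S) \<and>
    (has_subtype D S (\<ominus>, \<oplus>, \<oplus>) \<longrightarrow>
      cut_cofinality D =o natLeq \<and> cut_coinitiality D =o natLeq) \<and>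
    (has_subtype D S (\<ominus>, \<oplus>, \<ominus>) \<longrightarrow>
      cut_cofinality D =o natLeq \<and> cut_coinitiality D =o lambda_init S) \<and>
    (has_subtype D S (\<ominus>, \<ominus>, \<oplus>) \<longrightarrow>
      cut_cofinality D =o kappa_init S \<and> cut_coinitiality D =o natLeq) \<and>
    (has_subtype D S (\<ominus>, \<ominus>, \<ominus>) \<longrightarrow>
      cut_cofinality D =o kappa_init S \<and> cut_coinitiality D =o lambda_init S)"
proof -
  note S = \<open>S \<in> Init_I\<close>
  let ?H = "cofinality (\<le>) (H_of S)" and ?U = "coinitiality (\<le>) (elements_above (H_of S))"
  have pos: "cut_cofinality D =o ?H \<and> cut_coinitiality D =o ?U" if "has_subtype D S (\<oplus>, s, t)" for s t
    using that cut_cofinality_above_coset cut_coinitiality_above_coset by (auto simp: has_subtype_def)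
  have neg: "cut_cofinality D =o ?U \<and> cut_coinitiality D =o ?H" if "has_subtype D S (\<ominus>, s, t)" for s t
    using that cut_cofinality_below_coset[of "H_of S"] cut_coinitiality_below_coset[of "H_of S"]
      uminus_mem_H_of[of _ S]
    by (auto simp: has_subtype_def)
  have U_max: "?U =o natLeq" if "has_subtype D S (r, \<oplus>, t)" for r t
    using that coinitiality_elements_above_has_max[OF div_hull_divisible S]
    by (auto simp: has_subtype_def split: if_splits)
  have U_no_max: "?U =o kappa_init S" if "has_subtype D S (r, \<ominus>, t)" for r t
    using that coinitiality_elements_above_no_max[OF S]
    by (auto simp: has_subtype_def split: if_splits)
  have H_min: "?H =o natLeq" if "has_subtype D S (r, s, \<oplus>)" for r s
    using that cofinality_H_of_has_min[OF S] by (auto simp: has_subtype_def split: if_splits)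
  have H_no_min: "?H =o lambda_init S" if "has_subtype D S (r, s, \<ominus>)" for r s
    using that cofinality_H_of_no_min[OF S] by (auto simp: has_subtype_def split: if_splits)
  show ?thesis
    by (intro conjI impI)
      (blast intro: ordIso_transitive[OF pos[THEN conjunct1] H_min]
        ordIso_transitive[OF pos[THEN conjunct1] H_no_min]
        ordIso_transitive[OF pos[THEN conjunct2] U_max]
        ordIso_transitive[OF pos[THEN conjunct2] U_no_max]
        ordIso_transitive[OF neg[THEN conjunct1] U_max]
        ordIso_transitive[OF neg[THEN conjunct1] U_no_max]
        ordIso_transitive[OF neg[THEN conjunct2] H_min]
        ordIso_transitive[OF neg[THEN conjunct2] H_no_min])+
qed

end
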